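(* Let $\mathbb{P}$ and $\mathbb{Q}$ be non-degenerate probability measures on $\mathbb{R}^d$, let $X\sim\mathbb{P}$ and $Y\sim\mathbb{Q}$ be random variables in $\mathbb{R}^d$, and suppose that $\phi^*:\mathbb{R}^d\to\mathbb{R}^d$ is an optimal transport map from $\mathbb{P}$ to $\mathbb{Q}$ with respect to $W_2$ (so in particular $\phi^*_{\#}\mathbb{P}=\mathbb{Q}$). Let $A$ be a $d\times d$ orthonormal matrix. Let $\mathbb{P}_A=A_{\#}\mathbb{P}$ and $\mathbb{Q}_A=A_{\#}\mathbb{Q}$ be the laws of $AX$ and $AY$ respectively, and let $X_A$ and $Y_A$ be random variables with $X_A\sim\mathbb{P}_A$ and $Y_A\sim\mathbb{Q}_A$. Then: (1) the map $\phi_A^*(\mathbf{x})=A\,\phi^*(A'\mathbf{x})$ is an optimal transport map from $X_A$ to $Y_A$, i.e. from $\mathbb{P}_A$ to $\mathbb{Q}_A$, with respect to $W_2$; (2) $W_2(\mathbb{P}_A,\mathbb{Q}_A)=W_2(\mathbb{P},\mathbb{Q})$.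
   Context: For probability measures $\mathbb{P},\mathbb{Q}$ on $\mathbb{R}^d$, the quadratic Wasserstein distance is defined by $$W_2^2(\mathbb{P},\mathbb{Q})=\inf_{\pi\in\Pi(\mathbb{P},\mathbb{Q})}\int_{\mathbb{R}^{2d}}\|\mathbf{x}-\mathbf{y}\|_2^2\,d\pi(\mathbf{x},\mathbf{y}),$$ where $\Pi(\mathbb{P},\mathbb{Q})$ is the set of probability measures on $\mathbb{R}^{2d}$ with marginals $\mathbb{P}$ and $\mathbb{Q}$. A measurable map $\phi^*$ is an optimal transport map from $\mathbb{P}$ to $\mathbb{Q}$ (equivalently, between $X\sim\mathbb{P}$ and $Y\sim\mathbb{Q}$) if $\phi^*(X)\sim\mathbb{Q}$ when $X\sim\mathbb{P}$, and the joint law of $(X,\phi^*(X))$ attains the infimum above. A $d\times d$ real matrix $A$ is orthonormal if $A'A=AA'=I$, where $'$ denotes transpose. For a measurable map $T$, $T_{\#}\mathbb{P}$ denotes the pushforward of $\mathbb{P}$ by $T$; $A_{\#}\mathbb{P}$ is the pushforward under $\mathbf{x}\mapsto A\mathbf{x}$. *)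

theory Defs
  imports "HOL-Probability.Probability"
begin

definition borel_prob :: "'a::topological_space measure \<Rightarrow> bool" where
  "borel_prob P \<longleftrightarrow> prob_space P \<and> sets P = sets borel"

text \<open>A law is degenerate if it is a point mass. This is the narrowest notion of degeneracy in use:
  a law on \<open>real ^ 'n\<close> that is not concentrated on a proper affine subspace
  (e.g. one with a nonsingular covariance matrix) is nondegenerate in the sense below.\<close>

definition nondegenerate :: "'a::topological_space measure \<Rightarrow> bool" where
  "nondegenerate P \<longleftrightarrow> \<not> (\<exists>c. P = return borel c)"

definition has_law :: "'w measure \<Rightarrow> ('w \<Rightarrow> 'a::topological_space) \<Rightarrow> 'a measure \<Rightarrow> bool" where
  "has_law M X P \<longleftrightarrow> prob_space M \<and> X \<in> measurable M borel \<and> distr M borel X = P"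

definition couplings ::
  "'a::topological_space measure \<Rightarrow> 'a measure \<Rightarrow> ('a \<times> 'a) measure set" where
  "couplings P Q = {\<pi>. borel_prob \<pi> \<and> distr \<pi> borel fst = P \<and> distr \<pi> borel snd = Q}"

definition transport_cost :: "('a::real_normed_vector \<times> 'a) measure \<Rightarrow> ennreal" where
  "transport_cost \<pi> = (\<integral>\<^sup>+ (x, y). ennreal ((norm (x - y))\<^sup>2) \<partial>\<pi>)"

text \<open>No moments are assumed to be finite, so the distance takes values in \<^typ>\<open>ennreal\<close>.\<close>

definition W2_squared :: "'a::real_normed_vector measure \<Rightarrow> 'a measure \<Rightarrow> ennreal" where
  "W2_squared P Q = (INF \<pi> \<in> couplings P Q. transport_cost \<pi>)"

definition W2 :: "'a::real_normed_vector measure \<Rightarrow> 'a measure \<Rightarrow> ennreal" where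
  "W2 P Q = (if W2_squared P Q = \<infinity> then \<infinity>
             else ennreal (sqrt (enn2real (W2_squared P Q))))"

definition optimal_coupling ::
  "'a::real_normed_vector measure \<Rightarrow> 'a measure \<Rightarrow> ('a \<times> 'a) measure \<Rightarrow> bool" where
  "optimal_coupling P Q \<pi> \<longleftrightarrow> \<pi> \<in> couplings P Q \<and> transport_cost \<pi> = W2_squared P Q"

definition optimal_transport_map ::
  "'a::real_normed_vector measure \<Rightarrow> 'a measure \<Rightarrow> ('a \<Rightarrow> 'a) \<Rightarrow> bool" where
  "optimal_transport_map P Q \<phi> \<longleftrightarrow>
     \<phi> \<in> measurable borel borel \<and>
     distr P borel \<phi> = Q \<and>
     optimal_coupling P Q (distr P borel (\<lambda>x. (x, \<phi> x)))"

text \<open>The same notion for random variables \<open>X\<close> on \<open>M\<close> and \<open>Y\<close> on \<open>N\<close>;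
  the two probability spaces may differ.\<close>

definition optimal_transport_map_rv ::
  "'w measure \<Rightarrow> ('w \<Rightarrow> 'a::real_normed_vector) \<Rightarrow> 'v measure \<Rightarrow> ('v \<Rightarrow> 'a) \<Rightarrow> ('a \<Rightarrow> 'a) \<Rightarrow> bool" where
  "optimal_transport_map_rv M X N Y \<phi> \<longleftrightarrow>
     \<phi> \<in> measurable borel borel \<and>
     distr M borel (\<lambda>\<omega>. \<phi> (X \<omega>)) = distr N borel Y \<and>
     optimal_coupling (distr M borel X) (distr N borel Y) (distr M borel (\<lambda>\<omega>. (X \<omega>, \<phi> (X \<omega>))))"

end

theory Submission
  imports Defs
begin

text \<open>
  The quadratic cost only depends on distances, so moving both coordinates of a coupling by an
  isometry \<open>T\<close> gives a coupling of the two transported laws with the same cost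
  (\<open>distr_map_prod_couplings\<close>, \<open>transport_cost_distr_isometry\<close>). Hence \<open>W2_squared\<close> cannot
  increase under \<open>T\<close>; when \<open>T\<close> has an inverse \<open>S\<close>, applying this to \<open>S\<close>, which is an isometry as
  well, gives equality (\<open>W2_squared_distr_isometry\<close>), and optimal couplings are carried to optimal
  couplings. The coupling carried by the graph of \<open>\<phi>\<close> is moved to the one carried by the graph of
  \<open>T \<circ> \<phi> \<circ> S\<close>, which is therefore an optimal map. For an orthogonal matrix, \<open>T\<close> is multiplication
  by \<open>A\<close> and \<open>S\<close> multiplication by its transpose.
\<close>

lemma borel_measurable_isometry:
  fixes T :: "'a::metric_space \<Rightarrow> 'b::metric_space"
  assumes "\<And>x y. dist (T x) (T y) = dist x y"
  shows "T \<in> borel_measurable borel"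
proof -
  have "continuous_on UNIV T"
    unfolding continuous_on_iff using assms by auto
  then show ?thesis
    by (rule borel_measurable_continuous_onI)
qed

lemma borel_measurable_map_prod:
  fixes T :: "'a::second_countable_topology \<Rightarrow> 'b::second_countable_topology"
    and U :: "'c::second_countable_topology \<Rightarrow> 'd::second_countable_topology"
  assumes "T \<in> borel_measurable borel" and "U \<in> borel_measurable borel"
  shows "map_prod T U \<in> borel_measurable borel"
proof -
  have "(\<lambda>p. (T (fst p), U (snd p))) \<in> borel \<Otimes>\<^sub>M borel \<rightarrow>\<^sub>M borel \<Otimes>\<^sub>M borel"
    using assms by measurable
  then show ?thesis
    by (simp add: borel_prod map_prod_def case_prod_beta')
qed

lemma distr_map_prod_couplings:
  fixes P Q :: "'a::second_countable_topology measure"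
    and T :: "'a \<Rightarrow> 'b::second_countable_topology"
  assumes \<pi>: "\<pi> \<in> couplings P Q" and T: "T \<in> borel_measurable borel"
  shows "distr \<pi> borel (map_prod T T) \<in> couplings (distr P borel T) (distr Q borel T)"
proof -
  have prob: "prob_space \<pi>" and sets: "sets \<pi> = sets borel"
    and P: "P = distr \<pi> borel fst" and Q: "Q = distr \<pi> borel snd"
    using \<pi> by (auto simp: couplings_def borel_prob_def)
  have fst: "fst \<in> borel_measurable (borel :: ('a \<times> 'a) measure)"
    and snd: "snd \<in> borel_measurable (borel :: ('a \<times> 'a) measure)"
    and fst': "fst \<in> borel_measurable (borel :: ('b \<times> 'b) measure)"
    and snd': "snd \<in> borel_measurable (borel :: ('b \<times> 'b) measure)"
    by (intro borel_measurable_continuous_onI continuous_intros)+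
  note TT = borel_measurable_map_prod[OF T T]
  have meas: "f \<in> \<pi> \<rightarrow>\<^sub>M M" if "f \<in> borel \<rightarrow>\<^sub>M M" for f :: "'a \<times> 'a \<Rightarrow> 'c" and M
    using that by (simp cong: measurable_cong_sets add: sets)
  have "prob_space (distr \<pi> borel (map_prod T T))"
    using prob meas[OF TT] by (rule prob_space.prob_space_distr)
  moreover have "distr (distr \<pi> borel (map_prod T T)) borel fst = distr P borel T"
    unfolding P by (simp add: distr_distr meas TT T fst fst' comp_def)
  moreover have "distr (distr \<pi> borel (map_prod T T)) borel snd = distr Q borel T"
    unfolding Q by (simp add: distr_distr meas TT T snd snd' comp_def)
  ultimately show ?thesis
    by (simp add: couplings_def borel_prob_def)
qed

lemma transport_cost_distr_isometry:
  fixes T :: "'a::{real_normed_vector, second_countable_topology} \<Rightarrow> 'a"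
  assumes sets: "sets \<pi> = sets borel" and T: "\<And>x y. dist (T x) (T y) = dist x y"
  shows "transport_cost (distr \<pi> borel (map_prod T T)) = transport_cost \<pi>"
proof -
  let ?c = "\<lambda>(x, y). ennreal ((norm (x - y))\<^sup>2) :: ennreal"
  have "(\<lambda>p::'a \<times> 'a. (norm (fst p - snd p))\<^sup>2) \<in> borel_measurable borel"
    by (intro borel_measurable_continuous_onI continuous_intros)
  then have c: "?c \<in> borel_measurable (borel :: ('a \<times> 'a) measure)"
    by (simp add: case_prod_beta')
  have TT: "map_prod T T \<in> \<pi> \<rightarrow>\<^sub>M borel"
    using borel_measurable_map_prod[OF borel_measurable_isometry[OF T] borel_measurable_isometry[OF T]]
    by (simp cong: measurable_cong_sets add: sets)
  have "transport_cost (distr \<pi> borel (map_prod T T)) = (\<integral>\<^sup>+ p. ?c (map_prod T T p) \<partial>\<pi>)"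
    unfolding transport_cost_def by (rule nn_integral_distr[OF TT]) (simp add: c)
  also have "\<dots> = transport_cost \<pi>"
    using T by (simp add: transport_cost_def map_prod_def case_prod_beta' dist_norm)
  finally show ?thesis .
qed

lemma W2_squared_distr_isometry_le:
  fixes T :: "'a::{real_normed_vector, second_countable_topology} \<Rightarrow> 'a"
  assumes T: "\<And>x y. dist (T x) (T y) = dist x y"
  shows "W2_squared (distr P borel T) (distr Q borel T) \<le> W2_squared P Q"
  unfolding W2_squared_def
proof (rule INF_mono)
  fix \<pi> assume \<pi>: "\<pi> \<in> couplings P Q"
  then have "sets \<pi> = sets borel"
    by (simp add: couplings_def borel_prob_def)
  then have "transport_cost (distr \<pi> borel (map_prod T T)) \<le> transport_cost \<pi>"
    using transport_cost_distr_isometry[OF _ T] by simp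
  with distr_map_prod_couplings[OF \<pi> borel_measurable_isometry[OF T]]
  show "\<exists>\<rho>\<in>couplings (distr P borel T) (distr Q borel T). transport_cost \<rho> \<le> transport_cost \<pi>"
    by blast
qed

lemma distr_distr_left_inverse:
  assumes "sets P = sets borel"
    and "T \<in> borel_measurable borel" and "S \<in> borel_measurable borel" and "\<And>x. S (T x) = x"
  shows "distr (distr P borel T) borel S = P"
proof -
  have "T \<in> P \<rightarrow>\<^sub>M borel"
    using assms(1,2) by (simp cong: measurable_cong_sets)
  then have "distr (distr P borel T) borel S = distr P borel (\<lambda>x. x)"
    using assms(3,4) by (simp add: distr_distr comp_def)
  also have "\<dots> = P"
    by (rule distr_id2) (simp add: assms(1))
  finally show ?thesis .
qed

text \<open>Both inequalities come from \<open>W2_squared_distr_isometry_le\<close>: once for \<open>T\<close>, and once for its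
  inverse, which brings the transported laws back to \<open>P\<close> and \<open>Q\<close>.\<close>

lemma W2_squared_distr_isometry:
  fixes T S :: "'a::{real_normed_vector, second_countable_topology} \<Rightarrow> 'a"
  assumes P: "sets P = sets borel" and Q: "sets Q = sets borel"
    and T: "\<And>x y. dist (T x) (T y) = dist x y"
    and ST: "\<And>x. S (T x) = x" and TS: "\<And>x. T (S x) = x"
  shows "W2_squared (distr P borel T) (distr Q borel T) = W2_squared P Q"
proof (rule antisym)
  show "W2_squared (distr P borel T) (distr Q borel T) \<le> W2_squared P Q"
    by (rule W2_squared_distr_isometry_le[OF T])
  have S: "dist (S x) (S y) = dist x y" for x y
    using T[of "S x" "S y"] by (simp add: TS)
  note inv = distr_distr_left_inverse[OF _ borel_measurable_isometry[OF T]
      borel_measurable_isometry[OF S] ST]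
  show "W2_squared P Q \<le> W2_squared (distr P borel T) (distr Q borel T)"
    using W2_squared_distr_isometry_le[OF S, of "distr P borel T" "distr Q borel T"]
    by (simp add: inv P Q)
qed

lemma optimal_coupling_distr_isometry:
  fixes T S :: "'a::{real_normed_vector, second_countable_topology} \<Rightarrow> 'a"
  assumes P: "sets P = sets borel" and Q: "sets Q = sets borel"
    and T: "\<And>x y. dist (T x) (T y) = dist x y"
    and ST: "\<And>x. S (T x) = x" and TS: "\<And>x. T (S x) = x"
    and opt: "optimal_coupling P Q \<pi>"
  shows "optimal_coupling (distr P borel T) (distr Q borel T) (distr \<pi> borel (map_prod T T))"
proof -
  have \<pi>: "\<pi> \<in> couplings P Q" and cost: "transport_cost \<pi> = W2_squared P Q"
    using opt by (simp_all add: optimal_coupling_def)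
  have "sets \<pi> = sets borel"
    using \<pi> by (simp add: couplings_def borel_prob_def)
  then have "transport_cost (distr \<pi> borel (map_prod T T))
      = W2_squared (distr P borel T) (distr Q borel T)"
    by (simp add: transport_cost_distr_isometry T cost W2_squared_distr_isometry[OF P Q T ST TS])
  then show ?thesis
    using distr_map_prod_couplings[OF \<pi> borel_measurable_isometry[OF T]]
    by (simp add: optimal_coupling_def)
qed

text \<open>Conjugating \<open>\<phi>\<close> by \<open>T\<close> corresponds to moving its graph by \<open>T\<close> in both coordinates: the point
  \<open>(x, \<phi> x)\<close> goes to \<open>(T x, T (\<phi> x))\<close>, which lies on the graph of \<open>T \<circ> \<phi> \<circ> S\<close> over \<open>T x\<close>.\<close>

lemma optimal_transport_map_conjugate_isometry:
  fixes T S :: "'a::{real_normed_vector, second_countable_topology} \<Rightarrow> 'a"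
  assumes P: "sets P = sets borel" and Q: "sets Q = sets borel"
    and T: "\<And>x y. dist (T x) (T y) = dist x y"
    and ST: "\<And>x. S (T x) = x" and TS: "\<And>x. T (S x) = x"
    and opt: "optimal_transport_map P Q \<phi>"
  shows "optimal_transport_map (distr P borel T) (distr Q borel T) (\<lambda>x. T (\<phi> (S x)))"
proof -
  let ?\<psi> = "\<lambda>x. T (\<phi> (S x))"
  have \<phi>: "\<phi> \<in> borel_measurable borel" and dist\<phi>: "distr P borel \<phi> = Q"
    and coup: "optimal_coupling P Q (distr P borel (\<lambda>x. (x, \<phi> x)))"
    using opt by (simp_all add: optimal_transport_map_def)
  have S: "dist (S x) (S y) = dist x y" for x y
    using T[of "S x" "S y"] by (simp add: TS)
  note mT = borel_measurable_isometry[OF T] and mS = borel_measurable_isometry[OF S]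
  note TT = borel_measurable_map_prod[OF mT mT]
  have \<psi>: "?\<psi> \<in> borel_measurable borel"
    using mT mS \<phi> by measurable
  have meas: "f \<in> P \<rightarrow>\<^sub>M M" if "f \<in> borel \<rightarrow>\<^sub>M M" for f :: "'a \<Rightarrow> 'c" and M
    using that by (simp cong: measurable_cong_sets add: P)
  have graph: "(\<lambda>x. (x, f x)) \<in> borel_measurable borel"
    if "f \<in> borel_measurable borel" for f :: "'a \<Rightarrow> 'a"
    using that by (intro borel_measurable_Pair) simp_all
  have "distr (distr P borel T) borel ?\<psi> = distr (distr P borel \<phi>) borel T"
    by (simp add: distr_distr meas mT \<phi> \<psi> comp_def ST)
  then have push: "distr (distr P borel T) borel ?\<psi> = distr Q borel T"
    by (simp add: dist\<phi>)
  have "distr (distr P borel (\<lambda>x. (x, \<phi> x))) borel (map_prod T T)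
      = distr (distr P borel T) borel (\<lambda>x. (x, ?\<psi> x))"
    by (simp add: distr_distr meas mT graph[OF \<phi>] graph[OF \<psi>] TT comp_def ST)
  with optimal_coupling_distr_isometry[OF P Q T ST TS coup]
  have "optimal_coupling (distr P borel T) (distr Q borel T)
      (distr (distr P borel T) borel (\<lambda>x. (x, ?\<psi> x)))"
    by simp
  with \<psi> push show ?thesis
    by (simp add: optimal_transport_map_def)
qed

text \<open>Optimality of a map between random variables is a property of their laws, whatever the
  probability spaces that carry them.\<close>

lemma optimal_transport_map_rv_iff_law:
  fixes X :: "'w \<Rightarrow> 'a::{real_normed_vector, second_countable_topology}"
  assumes "has_law M X P" and "has_law N Y Q"
  shows "optimal_transport_map_rv M X N Y \<phi> \<longleftrightarrow> optimal_transport_map P Q \<phi>"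
proof (cases "\<phi> \<in> borel_measurable borel")
  case True
  have X: "X \<in> borel_measurable M" and P: "distr M borel X = P" and Q: "distr N borel Y = Q"
    using assms by (simp_all add: has_law_def)
  have graph: "(\<lambda>x. (x, \<phi> x)) \<in> borel_measurable borel"
    using True by (intro borel_measurable_Pair) simp_all
  have "distr M borel (\<lambda>\<omega>. \<phi> (X \<omega>)) = distr P borel \<phi>"
    and "distr M borel (\<lambda>\<omega>. (X \<omega>, \<phi> (X \<omega>))) = distr P borel (\<lambda>x. (x, \<phi> x))"
    unfolding P[symmetric] by (simp_all add: distr_distr X True graph comp_def)
  then show ?thesis
    by (simp add: optimal_transport_map_rv_def optimal_transport_map_def P Q)
qed (simp add: optimal_transport_map_rv_def optimal_transport_map_def)

lemma has_law_comp:
  assumes "has_law M X P" and "T \<in> borel_measurable borel"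
  shows "has_law M (\<lambda>\<omega>. T (X \<omega>)) (distr P borel T)"
proof -
  have X: "X \<in> borel_measurable M" and P: "P = distr M borel X" and "prob_space M"
    using assms(1) by (auto simp: has_law_def)
  then show ?thesis
    unfolding P using assms(2)
    by (simp add: has_law_def distr_distr comp_def measurable_compose[OF X])
qed

theorem theorem2p1:
  fixes P Q P\<^sub>A Q\<^sub>A :: "(real ^ 'n) measure"
    and M :: "'m measure" and X :: "'m \<Rightarrow> real ^ 'n"
    and N :: "'k measure" and Y :: "'k \<Rightarrow> real ^ 'n"
    and M\<^sub>A :: "'ma measure" and X\<^sub>A :: "'ma \<Rightarrow> real ^ 'n"
    and N\<^sub>A :: "'ka measure" and Y\<^sub>A :: "'ka \<Rightarrow> real ^ 'n"
    and \<phi> :: "real ^ 'n \<Rightarrow> real ^ 'n"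
    and A :: "real ^ 'n ^ 'n"
  assumes "borel_prob P" and "borel_prob Q"
    and "nondegenerate P" and "nondegenerate Q"
    and "has_law M X P" and "has_law N Y Q"
    and "optimal_transport_map P Q \<phi>"
    and "orthogonal_matrix A"
    and "P\<^sub>A = distr P borel (\<lambda>x. A *v x)" and "Q\<^sub>A = distr Q borel (\<lambda>x. A *v x)"
    and "has_law M\<^sub>A X\<^sub>A P\<^sub>A" and "has_law N\<^sub>A Y\<^sub>A Q\<^sub>A"
  shows "has_law M (\<lambda>\<omega>. A *v X \<omega>) P\<^sub>A \<and> has_law N (\<lambda>\<omega>. A *v Y \<omega>) Q\<^sub>A \<and>
         optimal_transport_map_rv M\<^sub>A X\<^sub>A N\<^sub>A Y\<^sub>A (\<lambda>x. A *v \<phi> (transpose A *v x)) \<and>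
         optimal_transport_map P\<^sub>A Q\<^sub>A (\<lambda>x. A *v \<phi> (transpose A *v x)) \<and>
         W2 P\<^sub>A Q\<^sub>A = W2 P Q"
proof -
  let ?T = "\<lambda>x. A *v x" and ?S = "\<lambda>x. transpose A *v x"
  have P: "sets P = sets borel" and Q: "sets Q = sets borel"
    using assms(1,2) by (simp_all add: borel_prob_def)
  have "orthogonal_transformation ?T"
    using assms(8) by (simp add: orthogonal_transformation_matrix)
  then have T: "dist (A *v x) (A *v y) = dist x y" for x y
    by (simp add: dist_norm orthogonal_transformation_norm
        flip: matrix_vector_mult_diff_distrib)
  have ST: "transpose A *v (A *v x) = x" and TS: "A *v (transpose A *v x) = x" for x
    using assms(8) by (simp_all add: orthogonal_matrix_def matrix_vector_mul_assoc del: transpose_matrix_vector)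
  note mT = borel_measurable_isometry[OF T]
  have opt: "optimal_transport_map P\<^sub>A Q\<^sub>A (\<lambda>x. A *v \<phi> (transpose A *v x))"
    unfolding assms(9,10)
    by (rule optimal_transport_map_conjugate_isometry[where S = ?S, OF P Q T ST TS assms(7)])
  moreover have "optimal_transport_map_rv M\<^sub>A X\<^sub>A N\<^sub>A Y\<^sub>A (\<lambda>x. A *v \<phi> (transpose A *v x))"
    using opt by (simp add: optimal_transport_map_rv_iff_law[OF assms(11,12)])
  moreover have "has_law M (\<lambda>\<omega>. A *v X \<omega>) P\<^sub>A" and "has_law N (\<lambda>\<omega>. A *v Y \<omega>) Q\<^sub>A"
    unfolding assms(9,10) by (rule has_law_comp[OF _ mT], fact)+
  moreover have "W2 P\<^sub>A Q\<^sub>A = W2 P Q"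
    unfolding assms(9,10) W2_def
    by (simp add: W2_squared_distr_isometry[where S = ?S, OF P Q T ST TS])
  ultimately show ?thesis
    by blast
qed

end
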